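(* If $0\le a\le 1$, then $$\lim_{n\to\infty}\frac{\log|B(I,an)|}{n\log n}=a .$$
   Context: $\mathcal S_n$ is the set of permutations of $\{1,\dots,n\}$, with $d(x,y)$ the graph distance in the Cayley graph of $\mathcal S_n$ with respect to the set of all transpositions. $I$ is the identity permutation and $B(I,an)=\{\sigma\in\mathcal S_n: d(I,\sigma)\le an\}$ is the ball of radius $an$ around $I$. (In words: $|B(I,an)|\approx(n!)^a$ in a logarithmic sense.) *)

theory Defs
  imports Complex_Main "HOL-Combinatorics.Permutations"
begin

definition sym_set :: "nat \<Rightarrow> (nat \<Rightarrow> nat) set" where
  "sym_set n = {\<sigma>. \<sigma> permutes {1..n}}"

definition transpositions :: "nat \<Rightarrow> (nat \<Rightarrow> nat) set" where
  "transpositions n = {transpose i j | i j. i \<in> {1..n} \<and> j \<in> {1..n} \<and> i \<noteq> j}"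

text \<open>
  Generators act by right multiplication. Left multiplication gives the same graph, because the set of
  transpositions is closed under conjugation.
\<close>
definition cayley_edges :: "nat \<Rightarrow> ((nat \<Rightarrow> nat) \<times> (nat \<Rightarrow> nat)) set" where
  "cayley_edges n = {(x, y). x \<in> sym_set n \<and> y \<in> sym_set n \<and> (\<exists>t \<in> transpositions n. y = x \<circ> t)}"

text \<open>
  The length of a shortest walk. The minimum exists for all vertices in \<^term>\<open>sym_set n\<close>, since the
  transpositions generate the symmetric group; other arguments are irrelevant.
\<close>
definition cayley_dist :: "nat \<Rightarrow> (nat \<Rightarrow> nat) \<Rightarrow> (nat \<Rightarrow> nat) \<Rightarrow> nat" where
  "cayley_dist n x y = (LEAST k. (x, y) \<in> cayley_edges n ^^ k)"

definition cayley_ball :: "nat \<Rightarrow> (nat \<Rightarrow> nat) \<Rightarrow> real \<Rightarrow> (nat \<Rightarrow> nat) set" where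
  "cayley_ball n x r = {\<sigma> \<in> sym_set n. real (cayley_dist n x \<sigma>) \<le> r}"

end

theory Submission
  imports Defs "HOL-Real_Asymp.Real_Asymp"
begin

text \<open>
  Write \<open>k\<close> for the integer part of \<open>an\<close>. The limit follows from the two bounds
  \<open>k! \<le> card B(I, an) \<le> 2 ^ n * n ^ k\<close>. Both logarithms are \<open>a n ln n + O(n)\<close>, and dividing by
  \<open>n ln n\<close> removes the error term.

  The upper bound needs care. Counting walks of length \<open>k\<close> gives about \<open>n ^ (2 * k)\<close> of them, because
  each step has about \<open>n ^ 2 / 2\<close> choices, and this is off by a factor of two in the exponent. However,
  many walks have the same endpoint: every product of \<open>k\<close> transpositions can be rewritten, without
  becoming longer, as
  \<open>(i\<^sub>1 j\<^sub>1) \<circ> \<dots> \<circ> (i\<^sub>r j\<^sub>r)\<close> with \<open>j\<^sub>1 < \<dots> < j\<^sub>r\<close> and every \<open>i\<^sub>s < j\<^sub>s\<close>, a staircase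
  factorisation. The set of the \<open>j\<^sub>s\<close> can be chosen in at most \<open>2 ^ n\<close> ways and each \<open>i\<^sub>s\<close> in at most
  \<open>n\<close> ways. The rewriting rests on \<open>staircase_closed_transpose\<close>, which lets one more transposition be
  absorbed at the cost of one more factor; the outcome is \<open>cayley_ball_eq_staircase\<close>, which replaces
  the ball by a recursively defined set.

  For the lower bound, the staircase form of a permutation of \<open>{1..k}\<close> has at most \<open>k\<close> factors, so the
  ball contains a copy of the whole symmetric group on \<open>k\<close> points.
\<close>

section \<open>Staircase factorisations\<close>

text \<open>
  The products of at most \<open>k\<close> transpositions \<open>(i j)\<close> with \<open>i < j \<le> n\<close> in which the larger entries
  \<open>j\<close> strictly increase from left to right. The number of factors is bounded, not prescribed,
  because a ball is a union of spheres.
\<close>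
primrec staircase :: "nat \<Rightarrow> nat \<Rightarrow> (nat \<Rightarrow> nat) set" where
  "staircase 0 k = {id}"
| "staircase (Suc n) k =
     staircase n k \<union>
     {\<tau> \<circ> transpose i (Suc n) | \<tau> i. k > 0 \<and> \<tau> \<in> staircase n (k - 1) \<and> i \<in> {1..n}}"

lemma staircase_stay: "\<sigma> \<in> staircase n k \<Longrightarrow> \<sigma> \<in> staircase (Suc n) k"
  by simp

lemma staircase_step:
  "\<tau> \<in> staircase n k \<Longrightarrow> i \<in> {1..n} \<Longrightarrow> \<tau> \<circ> transpose i (Suc n) \<in> staircase (Suc n) (Suc k)"
  by auto

lemma staircase_cases:
  assumes "\<sigma> \<in> staircase (Suc n) k"
  obtains "\<sigma> \<in> staircase n k"
  | \<tau> i j where "k = Suc j" "\<tau> \<in> staircase n j" "i \<in> {1..n}" "\<sigma> = \<tau> \<circ> transpose i (Suc n)"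
proof -
  consider "\<sigma> \<in> staircase n k"
    | \<tau> i where "k > 0" "\<tau> \<in> staircase n (k - 1)" "i \<in> {1..n}" "\<sigma> = \<tau> \<circ> transpose i (Suc n)"
    using assms by auto
  then show thesis
  proof cases
    case 1
    then show thesis by (rule that(1))
  next
    case 2
    then show thesis using that(2)[of "k - 1"] by simp
  qed
qed

lemma staircase_mono: "k \<le> l \<Longrightarrow> staircase n k \<subseteq> staircase n l"
proof (induction n arbitrary: k l)
  case 0
  then show ?case by simp
next
  case (Suc n)
  show ?case
  proof
    fix \<sigma> assume "\<sigma> \<in> staircase (Suc n) k"
    then show "\<sigma> \<in> staircase (Suc n) l"
    proof (cases rule: staircase_cases)
      case 1
      then show ?thesis using Suc by (intro staircase_stay) blast
    next
      case (2 \<tau> i j)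
      then obtain l' where l': "l = Suc l'" "j \<le> l'"
        using Suc.prems by (cases l) auto
      then have "\<tau> \<in> staircase n l'"
        using Suc.IH 2(2) by blast
      then show ?thesis
        unfolding 2(4) l'(1) using 2(3) by (rule staircase_step)
    qed
  qed
qed

lemma staircase_mono_points: "m \<le> n \<Longrightarrow> staircase m k \<subseteq> staircase n k"
  by (induction n rule: dec_induct) auto

lemma id_in_staircase: "id \<in> staircase n k"
  by (induction n) auto

text \<open>
  The new transposition is pushed to the left past the factor \<open>(h N)\<close> with the largest entry
  \<open>N = n + 1\<close>, by one of the identities
  \<open>(h N) \<circ> (i j) = (i j) \<circ> (t(h) N)\<close> for \<open>t = (i j)\<close> and \<open>i, j \<noteq> N\<close>;
  \<open>(h N) \<circ> (i N) = (h i) \<circ> (h N)\<close> for \<open>h \<noteq> i\<close>; and \<open>(h N) \<circ> (h N) = id\<close>. In the first two cases,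
  what arrives on the left moves only points up to \<open>n\<close>, so the induction hypothesis absorbs it.
\<close>
lemma staircase_closed_transpose:
  assumes "\<sigma> \<in> staircase n k" "i \<in> {1..n}" "j \<in> {1..n}" "i \<noteq> j"
  shows "\<sigma> \<circ> transpose i j \<in> staircase n (Suc k)"
  using assms
proof (induction n arbitrary: \<sigma> k i j)
  case 0
  then show ?case by simp
next
  case (Suc n)
  have below: "\<sigma> \<circ> transpose i j \<in> staircase (Suc n) (Suc k)"
    if \<sigma>: "\<sigma> \<in> staircase (Suc n) k" and ij: "i \<in> {1..n}" "j \<in> {1..n}" "i \<noteq> j" for \<sigma> k i j
    using \<sigma>
  proof (cases rule: staircase_cases)
    case 1
    then show ?thesis using Suc.IH ij by (intro staircase_stay)
  next
    case (2 \<tau> h l)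
    have "\<sigma> \<circ> transpose i j = (\<tau> \<circ> transpose i j) \<circ> transpose (transpose i j h) (Suc n)"
      using 2(3) ij unfolding 2(4) by (auto simp: fun_eq_iff transpose_def)
    moreover have "transpose i j h \<in> {1..n}"
      using 2(3) ij by (auto simp: transpose_def)
    ultimately show ?thesis
      using Suc.IH[OF 2(2) ij] 2(1) staircase_step by metis
  qed
  have top: "\<sigma> \<circ> transpose i (Suc n) \<in> staircase (Suc n) (Suc k)"
    if \<sigma>: "\<sigma> \<in> staircase (Suc n) k" and i: "i \<in> {1..n}" for \<sigma> k i
    using \<sigma>
  proof (cases rule: staircase_cases)
    case 1
    then show ?thesis using i by (rule staircase_step)
  next
    case (2 \<tau> h l)
    show ?thesis
    proof (cases "h = i")
      case True
      then have "\<sigma> \<circ> transpose i (Suc n) = \<tau>"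
        unfolding 2(4) by (simp add: o_assoc[symmetric])
      moreover have "\<tau> \<in> staircase n (Suc k)"
        using 2(1,2) staircase_mono[of l "Suc k" n] by auto
      ultimately show ?thesis by (auto intro: staircase_stay)
    next
      case False
      have "\<sigma> \<circ> transpose i (Suc n) = (\<tau> \<circ> transpose h i) \<circ> transpose h (Suc n)"
        using 2(3) i False unfolding 2(4) by (auto simp: fun_eq_iff transpose_def)
      moreover have "\<tau> \<circ> transpose h i \<in> staircase n k"
        using Suc.IH[OF 2(2) 2(3) i False] unfolding 2(1) .
      ultimately show ?thesis
        using 2(3) staircase_step by metis
    qed
  qed
  consider "i \<in> {1..n}" "j \<in> {1..n}" | "i \<in> {1..n}" "j = Suc n" | "j \<in> {1..n}" "i = Suc n"
    using Suc.prems by (auto simp: le_Suc_eq)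
  then show ?case
  proof cases
    case 1
    then show ?thesis using below Suc.prems by blast
  next
    case 2
    then show ?thesis using top Suc.prems by blast
  next
    case 3
    then show ?thesis using top Suc.prems by (metis transpose_commute)
  qed
qed

text \<open>
  Cancelling the largest point \<open>n + 1\<close> against its preimage costs at most one transposition and leaves
  a permutation of \<open>{1..n}\<close>.
\<close>
lemma permutes_imp_staircase: "\<sigma> permutes {1..n} \<Longrightarrow> \<sigma> \<in> staircase n n"
proof (induction n arbitrary: \<sigma>)
  case 0
  then show ?case by (simp add: id_def)
next
  case (Suc n)
  define h where "h = inv \<sigma> (Suc n)"
  have h: "\<sigma> h = Suc n" "h \<in> {1..Suc n}"
    using Suc.prems permutes_inverses(1)[OF Suc.prems] permutes_in_image[OF permutes_inv[OF Suc.prems]]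
    by (auto simp: h_def)
  define \<tau> where "\<tau> = \<sigma> \<circ> transpose h (Suc n)"
  have "\<tau> permutes {1..Suc n}"
    unfolding \<tau>_def using h(2) by (intro permutes_compose[OF _ Suc.prems] permutes_swap_id) auto
  moreover have "\<tau> (Suc n) = Suc n"
    using h by (simp add: \<tau>_def)
  ultimately have "\<tau> permutes {1..n}"
    by (elim permutes_superset) (auto simp: le_Suc_eq)
  then have \<tau>: "\<tau> \<in> staircase n n"
    by (rule Suc.IH)
  have \<sigma>: "\<sigma> = \<tau> \<circ> transpose h (Suc n)"
    by (simp add: \<tau>_def o_assoc[symmetric])
  show ?case
  proof (cases "h = Suc n")
    case True
    then have "\<sigma> = \<tau>" using \<sigma> by simp
    then show ?thesis using \<tau> staircase_mono[of n "Suc n" n] by (auto intro: staircase_stay)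
  next
    case False
    then have "h \<in> {1..n}" using h(2) by (auto simp: le_Suc_eq)
    then show ?thesis unfolding \<sigma> using \<tau> by (intro staircase_step)
  qed
qed

lemma staircase_imp_permutes: "\<sigma> \<in> staircase n k \<Longrightarrow> \<sigma> permutes {1..n}"
proof (induction n arbitrary: \<sigma> k)
  case 0
  then show ?case by (simp add: id_def)
next
  case (Suc n)
  have up: "\<tau> permutes {1..Suc n}" if "\<tau> permutes {1..n}" for \<tau> :: "nat \<Rightarrow> nat"
    using that by (rule permutes_subset) auto
  from Suc.prems show ?case
  proof (cases rule: staircase_cases)
    case 1
    then show ?thesis using Suc.IH up by blast
  next
    case (2 \<tau> i l)
    then show ?thesis
      unfolding 2(4) by (intro permutes_compose permutes_swap_id up Suc.IH) auto
  qed
qed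

section \<open>The ball in the Cayley graph\<close>

lemma walk_imp_staircase: "(id, \<sigma>) \<in> cayley_edges n ^^ k \<Longrightarrow> \<sigma> \<in> staircase n k"
proof (induction k arbitrary: \<sigma>)
  case 0
  then show ?case by (auto simp: id_in_staircase[unfolded id_def])
next
  case (Suc k)
  from Suc.prems obtain \<tau> where \<tau>: "(id, \<tau>) \<in> cayley_edges n ^^ k" "(\<tau>, \<sigma>) \<in> cayley_edges n"
    by (rule relpow_Suc_E)
  then obtain i j where "\<sigma> = \<tau> \<circ> transpose i j" "i \<in> {1..n}" "j \<in> {1..n}" "i \<noteq> j"
    unfolding cayley_edges_def transpositions_def by auto
  then show ?case
    using staircase_closed_transpose Suc.IH[OF \<tau>(1)] by blast
qed

lemma cayley_edges_mono: "m \<le> n \<Longrightarrow> cayley_edges m \<subseteq> cayley_edges n"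
proof -
  assume mn: "m \<le> n"
  have "transpositions m \<subseteq> transpositions n"
    unfolding transpositions_def using mn by fastforce
  moreover have "sym_set m \<subseteq> sym_set n"
    unfolding sym_set_def using mn by (auto intro: permutes_subset)
  ultimately show ?thesis
    unfolding cayley_edges_def by blast
qed

lemma staircase_imp_walk:
  "\<sigma> \<in> staircase n k \<Longrightarrow> \<exists>j\<le>k. (id, \<sigma>) \<in> cayley_edges n ^^ j"
proof (induction n arbitrary: \<sigma> k)
  case 0
  then show ?case by (intro exI[of _ 0]) simp
next
  case (Suc n)
  have up: "(x, y) \<in> cayley_edges (Suc n) ^^ j" if "(x, y) \<in> cayley_edges n ^^ j" for x y j
    using that relpowp_mono[to_set, of "cayley_edges n" "cayley_edges (Suc n)"]
      cayley_edges_mono[of n "Suc n"] by auto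
  from Suc.prems show ?case
  proof (cases rule: staircase_cases)
    case 1
    then show ?thesis using Suc.IH up by blast
  next
    case (2 \<tau> i l)
    obtain j where j: "j \<le> l" "(id, \<tau>) \<in> cayley_edges n ^^ j"
      using Suc.IH[OF 2(2)] by blast
    have "\<tau> \<in> staircase (Suc n) l" using 2(2) by (rule staircase_stay)
    moreover have "transpose i (Suc n) \<in> transpositions (Suc n)"
      unfolding transpositions_def using 2(3) by fastforce
    ultimately have "(\<tau>, \<sigma>) \<in> cayley_edges (Suc n)"
      using Suc.prems 2(4) staircase_imp_permutes unfolding cayley_edges_def sym_set_def by blast
    then have "(id, \<sigma>) \<in> cayley_edges (Suc n) ^^ Suc j"
      using up[OF j(2)] by (rule relpow_Suc_I[rotated])
    then show ?thesis using j(1) 2(1) by blast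
  qed
qed

text \<open>
  The distance is a least walk length, so a member of the ball has a short walk only if it has a walk at
  all; connectedness comes from \<open>permutes_imp_staircase\<close> with the bound \<open>n\<close>.
\<close>
lemma cayley_ball_eq_staircase:
  assumes "r \<ge> 0"
  shows "cayley_ball n id r = staircase n (nat \<lfloor>r\<rfloor>)"
proof -
  have dist: "cayley_dist n id \<sigma> \<le> k \<longleftrightarrow> \<sigma> \<in> staircase n k" if "\<sigma> permutes {1..n}" for \<sigma> k
  proof
    assume le: "cayley_dist n id \<sigma> \<le> k"
    have "\<exists>j. (id, \<sigma>) \<in> cayley_edges n ^^ j"
      using staircase_imp_walk[OF permutes_imp_staircase[OF that]] by blast
    then have "(id, \<sigma>) \<in> cayley_edges n ^^ cayley_dist n id \<sigma>"
      unfolding cayley_dist_def by (rule LeastI_ex)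
    then show "\<sigma> \<in> staircase n k"
      using walk_imp_staircase staircase_mono[OF le] by blast
  next
    assume "\<sigma> \<in> staircase n k"
    then obtain j where "j \<le> k" "(id, \<sigma>) \<in> cayley_edges n ^^ j"
      using staircase_imp_walk by blast
    then show "cayley_dist n id \<sigma> \<le> k"
      unfolding cayley_dist_def by (meson Least_le order_trans)
  qed
  have "real d \<le> r \<longleftrightarrow> d \<le> nat \<lfloor>r\<rfloor>" for d
    using assms by (simp add: le_nat_floor le_nat_iff le_floor_iff)
  then show ?thesis
    unfolding cayley_ball_def sym_set_def using dist staircase_imp_permutes by auto
qed

section \<open>Counting\<close>

lemma finite_staircase: "finite (staircase n k)"
  using finite_subset[of "staircase n k" "{\<sigma>. \<sigma> permutes {1..n}}"] staircase_imp_permutes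
  by (auto simp: finite_permutations)

text \<open>
  Each of the \<open>n\<close> levels either contributes no factor or contributes one of at most \<open>N\<close> transpositions
  and uses up one unit of \<open>k\<close>. Keeping the base \<open>N\<close> fixed lets the induction on \<open>n\<close> close; it
  must be positive because the set for \<open>n = 0\<close> still contains the identity.
\<close>
lemma card_staircase_le:
  assumes "n \<le> N" "0 < N"
  shows "card (staircase n k) \<le> 2 ^ n * N ^ k"
  using assms
proof (induction n arbitrary: k)
  case 0
  then show ?case by simp
next
  case (Suc n)
  show ?case
  proof (cases k)
    case 0
    have "staircase (Suc n) k = staircase n k" using 0 by auto
    then show ?thesis using Suc.IH[of k] Suc.prems 0 by simp
  next
    case (Suc l)
    let ?f = "\<lambda>(\<tau>, i). \<tau> \<circ> transpose i (Suc n)"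
    have "staircase (Suc n) k = staircase n k \<union> ?f ` (staircase n l \<times> {1..n})"
      unfolding Suc by (simp only: staircase.simps) (fastforce simp: image_iff)
    then have "card (staircase (Suc n) k) \<le> card (staircase n k) + card (?f ` (staircase n l \<times> {1..n}))"
      by (simp only: card_Un_le)
    also have "card (?f ` (staircase n l \<times> {1..n})) \<le> card (staircase n l) * n"
      using card_image_le[of "staircase n l \<times> {1..n}" ?f]
      by (simp add: finite_staircase card_cartesian_product)
    also have "\<dots> \<le> (2 ^ n * N ^ l) * N"
      using Suc.IH[of l] Suc.prems by (intro mult_le_mono) auto
    also have "card (staircase n k) \<le> 2 ^ n * N ^ k"
      using Suc.IH[of k] Suc.prems by simp
    finally show ?thesis using Suc by (simp add: algebra_simps)
  qed
qed

text \<open>All permutations of the first \<open>k\<close> points belong to the staircase set.\<close>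
lemma fact_le_card_staircase:
  assumes "k \<le> n"
  shows "fact k \<le> card (staircase n k)"
proof -
  have "{\<sigma>. \<sigma> permutes {1..k}} \<subseteq> staircase n k"
    using permutes_imp_staircase staircase_mono_points[OF assms] by blast
  then have "card {\<sigma>. \<sigma> permutes {1..k}} \<le> card (staircase n k)"
    by (intro card_mono finite_staircase)
  then show ?thesis by (simp add: card_permutations)
qed

section \<open>Asymptotics\<close>

text \<open>The term of index \<open>m\<close> of the exponential series at \<open>m\<close> is at most \<open>exp m\<close>.\<close>
lemma ln_fact_ge:
  assumes "m > 0"
  shows "real m * (ln (real m) - 1) \<le> ln (fact m)"
proof -
  have "real m ^ m / fact m \<le> exp (real m)"
    using sum_le_suminf[OF summable_exp[of "real m"], of "{m}"]
    by (simp add: exp_def divide_inverse mult.commute)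
  then have "ln (real m ^ m / fact m) \<le> real m"
    using assms by (metis ln_exp ln_mono divide_pos_pos fact_gt_zero of_nat_0_less_iff zero_less_power)
  then show ?thesis
    using assms by (simp add: ln_div ln_realpow algebra_simps)
qed

theorem theorem2:
  fixes a :: real
  assumes "0 \<le> a" and "a \<le> 1"
  shows "(\<lambda>n::nat. ln (real (card (cayley_ball n id (a * real n)))) / (real n * ln (real n)))
           \<longlonglongrightarrow> a"
proof -
  define k where "k n = nat \<lfloor>a * real n\<rfloor>" for n
  define L where "L n = ln (real (card (cayley_ball n id (a * real n))))" for n
  have ball: "cayley_ball n id (a * real n) = staircase n (k n)" for n
    unfolding k_def using assms by (intro cayley_ball_eq_staircase) simp
  have k_le: "real (k n) \<le> a * real n" for n
    using assms by (simp add: k_def)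
  have k_ge: "a * real n - 1 \<le> real (k n)" for n
    unfolding k_def by linarith
  have "k n \<le> n" for n
    using k_le[of n] mult_right_mono[OF assms(2), of "real n"] by simp
  then have fact_le: "fact (k n) \<le> card (staircase n (k n))" for n
    by (rule fact_le_card_staircase)
  have lower_fact: "ln (fact (k n)) \<le> L n" for n
  proof -
    have "(fact (k n) :: real) \<le> real (card (staircase n (k n)))"
      using fact_le[of n] by (metis of_nat_fact of_nat_le_iff)
    then show ?thesis
      unfolding L_def ball by (intro ln_mono) auto
  qed
  have upper: "L n / (real n * ln (real n)) \<le> a + ln 2 / ln (real n)" if n: "n \<ge> 2" for n
  proof -
    have "0 < card (staircase n (k n))"
      using fact_le[of n] by (metis fact_gt_zero less_le_trans)
    moreover have "real (card (staircase n (k n))) \<le> 2 ^ n * real n ^ k n"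
    proof -
      have "card (staircase n (k n)) \<le> 2 ^ n * n ^ k n"
        using card_staircase_le[of n n "k n"] n by simp
      then have "real (card (staircase n (k n))) \<le> real (2 ^ n * n ^ k n)"
        by (rule of_nat_mono)
      then show ?thesis by simp
    qed
    ultimately have "L n \<le> ln (2 ^ n * real n ^ k n)"
      unfolding L_def ball using n by (intro ln_mono) auto
    also have "\<dots> = real n * ln 2 + real (k n) * ln (real n)"
      using n by (simp add: ln_mult ln_realpow)
    also have "\<dots> \<le> real n * ln 2 + a * real n * ln (real n)"
      using k_le[of n] n by (intro add_left_mono mult_right_mono) auto
    finally show ?thesis
      using n by (simp add: field_simps)
  qed
  then have upper_ev:
    "\<forall>\<^sub>F n in sequentially. L n / (real n * ln (real n)) \<le> a + ln 2 / ln (real n)"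
    by (rule eventually_sequentiallyI)
  have upper_lim: "(\<lambda>n. a + ln 2 / ln (real n)) \<longlonglongrightarrow> a"
    by real_asymp
  have "(\<lambda>n. L n / (real n * ln (real n))) \<longlonglongrightarrow> a"
    \<comment> \<open>For \<open>a = 0\<close> the argument \<open>a n - 1\<close> of the logarithm in the lower estimate is negative.\<close>
  proof (cases "a = 0")
    case True
    have "0 \<le> L n / (real n * ln (real n))" if "n \<ge> 2" for n
    proof -
      have "0 \<le> ln (fact (k n) :: real)" by (intro ln_ge_zero fact_ge_1)
      then have "0 \<le> L n" using lower_fact[of n] by linarith
      moreover have "0 \<le> real n * ln (real n)" using that by simp
      ultimately show ?thesis by (rule divide_nonneg_nonneg)
    qed
    then have "\<forall>\<^sub>F n in sequentially. a \<le> L n / (real n * ln (real n))"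
      unfolding True by (rule eventually_sequentiallyI)
    then show ?thesis
      using upper_ev tendsto_const upper_lim by (rule tendsto_sandwich)
  next
    case False
    then have a: "a > 0" using assms by simp
    define lo where
      "lo = (\<lambda>n. (a * real n - 1) * (ln (a * real n - 1) - 1) / (real n * ln (real n)))"
    \<comment> \<open>\<open>x (ln x - 1)\<close> is a product of nonnegative increasing factors from \<open>x = exp 1\<close> on, so \<open>k n\<close> may be
      replaced by its lower bound \<open>a n - 1\<close>.\<close>
    have large: "\<forall>\<^sub>F n in sequentially. a * real n - 1 \<ge> exp 1"
      using a by real_asymp
    have lower: "\<forall>\<^sub>F n in sequentially. lo n \<le> L n / (real n * ln (real n))"
      using large eventually_ge_at_top[of 2]
    proof eventually_elim
      case (elim n)
      have pos: "0 < a * real n - 1"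
        using elim(1) exp_gt_zero[of "1::real"] by linarith
      have ln1: "1 \<le> ln (a * real n - 1)"
        using elim(1) pos by (simp add: ln_ge_iff)
      have kpos: "0 < k n" using k_ge[of n] pos by linarith
      have "ln (a * real n - 1) \<le> ln (real (k n))"
        using k_ge[of n] pos by (intro ln_mono) auto
      then have "(a * real n - 1) * (ln (a * real n - 1) - 1) \<le> real (k n) * (ln (real (k n)) - 1)"
        using k_ge[of n] pos ln1 by (intro mult_mono) auto
      also have "\<dots> \<le> L n"
        using ln_fact_ge[OF kpos] lower_fact[of n] by simp
      finally show ?case
        unfolding lo_def using elim(2) by (intro divide_right_mono) auto
    qed
    have lower_lim: "lo \<longlonglongrightarrow> a"
      unfolding lo_def using a by real_asymp
    show ?thesis
      using lower upper_ev lower_lim upper_lim by (rule tendsto_sandwich)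
  qed
  then show ?thesis by (simp add: L_def)
qed

end
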